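(* Let $r\ge 2$ be a fixed integer and let $p=p(n)=1-o(1)$. Then, a.a.s., \[ \ell_{\max} = \frac{(1+o(1))\,n}{r-1}, \] where $\ell_{\max}$ is the maximal length of an ordered loose path in the random $r$-uniform hypergraph $H^{(r)}(n,p)$.
   Context: Let $r\ge 2$ be a fixed integer (constant). $H=H^{(r)}(n,p)$ is the random $r$-uniform hypergraph on the vertex set $[n]=\{1,\dots,n\}$ in which each $r$-element subset of $[n]$ is included as an edge independently with probability $p=p(n)\in[0,1]$. An ordered loose path of length $\ell$ in $H$ is an increasing sequence of vertices $v_1<v_2<\dots<v_{\ell(r-1)+1}$ in $[n]$ such that the $\ell$ sets $\{v_{(k-1)(r-1)+1},v_{(k-1)(r-1)+2},\dots,v_{k(r-1)+1}\}$, $k=1,\dots,\ell$, are all edges of $H$ (so every two consecutive edges intersect in a single vertex). $\ell_{\max}$ denotes the maximal length of an ordered loose path in $H$. All asymptotics are as $n\to\infty$; "a.a.s." means with probability tending to $1$ as $n\to\infty$. The conclusion means that there is a deterministic sequence $\delta_n\to0$ such that a.a.s. $(1-\delta_n)\frac{n}{r-1}\le\ell_{\max}\le(1+\delta_n)\frac{n}{r-1}$. *)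

theory Defs
  imports "HOL-Probability.Probability" "HOL-Library.Ramsey"
begin

text \<open>An \<open>r\<close>-uniform hypergraph on \<open>{1..n}\<close> is represented by its edge set, a subset of
  \<^term>\<open>nsets {1..n} r\<close>, the set of all \<open>r\<close>-element subsets of \<open>{1..n}\<close>.\<close>

definition random_hypergraph :: "nat \<Rightarrow> nat \<Rightarrow> real \<Rightarrow> nat set set pmf" where
  "random_hypergraph r n p =
     map_pmf (\<lambda>f. {e \<in> nsets {1..n} r. f e})
       (Pi_pmf (nsets {1..n} r) False (\<lambda>_. bernoulli_pmf p))"

text \<open>The vertex sequence is a function on \<open>nat\<close> of which only the values at
  \<open>1, \<dots>, l * (r - 1) + 1\<close> matter. For \<open>l = 0\<close> it is a single vertex.\<close>

definition ordered_loose_path ::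
    "nat \<Rightarrow> nat \<Rightarrow> nat set set \<Rightarrow> nat \<Rightarrow> (nat \<Rightarrow> nat) \<Rightarrow> bool" where
  "ordered_loose_path r n H l v \<longleftrightarrow>
     strict_mono_on {1..l * (r - 1) + 1} v \<and>
     v ` {1..l * (r - 1) + 1} \<subseteq> {1..n} \<and>
     (\<forall>k\<in>{1..l}. v ` {(k - 1) * (r - 1) + 1..k * (r - 1) + 1} \<in> H)"

definition max_path_length :: "nat \<Rightarrow> nat \<Rightarrow> nat set set \<Rightarrow> nat" where
  "max_path_length r n H = Max {l. \<exists>v. ordered_loose_path r n H l v}"

text \<open>The maximum ranges over a finite nonempty set as soon as \<open>r \<ge> 2\<close> and \<open>n \<ge> 1\<close>.\<close>

lemma ordered_loose_path_length_le:
  assumes "ordered_loose_path r n H l v"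
  shows "l * (r - 1) + 1 \<le> n"
proof -
  have "inj_on v {1..l * (r - 1) + 1}" "v ` {1..l * (r - 1) + 1} \<subseteq> {1..n}"
    using assms by (auto simp: ordered_loose_path_def intro: strict_mono_on_imp_inj_on)
  then have "card {1..l * (r - 1) + 1} \<le> card {1..n}"
    by (intro card_inj_on_le) auto
  then show ?thesis by simp
qed

lemma finite_path_lengths:
  assumes "r \<ge> 2"
  shows "finite {l. \<exists>v. ordered_loose_path r n H l v}"
proof (rule finite_subset)
  show "{l. \<exists>v. ordered_loose_path r n H l v} \<subseteq> {..n}"
  proof clarsimp
    fix l v assume "ordered_loose_path r n H l v"
    then have "l * (r - 1) + 1 \<le> n" by (rule ordered_loose_path_length_le)
    moreover have "l * 1 \<le> l * (r - 1)" using assms by (intro mult_le_mono) auto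
    ultimately show "l \<le> n" by linarith
  qed
qed simp

lemma path_lengths_nonempty:
  assumes "n \<ge> 1"
  shows "0 \<in> {l. \<exists>v. ordered_loose_path r n H l v}"
  using assms by (auto simp: ordered_loose_path_def strict_mono_on_def intro!: exI[of _ "\<lambda>_. 1"])

end

theory Submission
  imports Defs
begin

text \<open>With \<open>d = r - 1\<close>, cut the vertices following \<open>1\<close> into consecutive blocks of size \<open>d\<close> and grow
  a path greedily: the next block is appended to the path if it forms an edge together with
  the last vertex of the path, and is skipped otherwise. The path built from the first \<open>t\<close> blocks
  depends only on edges inside these blocks, so each block fails with probability exactly
  \<open>1 - p\<close>. By Markov's inequality, with probability at least \<open>1 - sqrt (1 - p)\<close> only about a
  proportion \<open>sqrt (1 - p)\<close> of the blocks is skipped.\<close>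

section \<open>Enlarging and extending ordered loose paths\<close>

lemma ordered_loose_path_mono:
  assumes "ordered_loose_path r n H l v" "n \<le> n'"
  shows "ordered_loose_path r n' H l v"
  using assms unfolding ordered_loose_path_def by fastforce

text \<open>All vertices of the path are at most \<open>n\<close>, so
  \<open>n + 1, ..., n + (r - 1)\<close> continue the increasing sequence. The new path is spelled
  out because \<open>greedy_path\<close> also has to know its last vertex.\<close>

lemma ordered_loose_path_extend:
  assumes path: "ordered_loose_path r n H l v"
    and edge: "insert (v (l * (r - 1) + 1)) {n + 1..n + (r - 1)} \<in> H"
  shows "ordered_loose_path r (n + (r - 1)) H (Suc l)
    (\<lambda>j. if j \<le> l * (r - 1) + 1 then v j else n + (j - (l * (r - 1) + 1)))"
proof -
  define d a where "d = r - 1" and "a = l * d + 1"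
  let ?w = "\<lambda>j. if j \<le> a then v j else n + (j - a)"
  have mono: "strict_mono_on {1..a} v" and bound: "v ` {1..a} \<subseteq> {1..n}"
    and edges: "\<And>k. k \<in> {1..l} \<Longrightarrow> v ` {(k - 1) * d + 1..k * d + 1} \<in> H"
    using path by (auto simp: ordered_loose_path_def a_def d_def)
  have len: "Suc l * d + 1 = a + d"
    by (simp add: a_def)
  have le_n: "1 \<le> v j \<and> v j \<le> n" if "1 \<le> j" "j \<le> a" for j
    using bound that by (auto simp: image_subset_iff)
  have "strict_mono_on {1..a + d} ?w"
  proof (rule strict_mono_onI)
    fix i j assume ij: "i \<in> {1..a + d}" "j \<in> {1..a + d}" "i < j"
    consider "j \<le> a" | "i \<le> a" "a < j" | "a < i"
      by linarith
    then show "?w i < ?w j"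
    proof cases
      case 1
      then show ?thesis
        using ij strict_mono_onD[OF mono, of i j] by auto
    next
      case 2
      then show ?thesis
        using ij le_n[of i] by auto
    qed (use ij in auto)
  qed
  moreover have "?w ` {1..a + d} \<subseteq> {1..n + d}"
    using le_n by (fastforce simp: image_subset_iff)
  moreover have "?w ` {(k - 1) * d + 1..k * d + 1} \<in> H" if k: "k \<in> {1..Suc l}" for k
  proof (cases "k = Suc l")
    case True
    have shift: "(+) x ` {1..d} = {x + 1..x + d}" for x :: nat
      by (simp add: image_add_atLeastAtMost add.commute)
    \<comment> \<open>The last edge consists of the shared vertex at index \<open>a\<close>, where
      the old branch of the new sequence applies, and \<open>d\<close> indices on the new
      branch.\<close>
    have "{(k - 1) * d + 1..k * d + 1} = insert a ((+) a ` {1..d})"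
      unfolding shift using True by (auto simp: a_def)
    also have "?w ` \<dots> = insert (v a) (?w ` (+) a ` {1..d})"
      by (simp only: image_insert order_refl if_True)
    also have "?w ` (+) a ` {1..d} = (+) n ` {1..d}"
      unfolding image_image by (intro image_cong) auto
    also have "insert (v a) \<dots> = insert (v (l * (r - 1) + 1)) {n + 1..n + (r - 1)}"
      unfolding shift by (simp add: a_def d_def)
    finally show ?thesis
      using edge by simp
  next
    case False
    then have k': "k \<in> {1..l}"
      using k by auto
    then have "k * d + 1 \<le> a"
      by (simp add: a_def)
    then have "?w ` {(k - 1) * d + 1..k * d + 1} = v ` {(k - 1) * d + 1..k * d + 1}"
      by (intro image_cong) auto
    then show ?thesis
      using edges[OF k'] by simp
  qed
  ultimately show ?thesis
    unfolding ordered_loose_path_def d_def[symmetric] a_def[symmetric] len by blast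
qed

section \<open>The greedy path and its skipped blocks\<close>

text \<open>Step \<open>t\<close> counts from 0, but the block tested there is block number
  \<open>Suc t\<close>, with last vertex \<open>Suc t * d + 1\<close>; \<open>u\<close> is the
  number of the block where the path ends.\<close>

definition block_edge :: "nat \<Rightarrow> nat \<Rightarrow> nat \<Rightarrow> nat set" where
  "block_edge d u t = insert (u * d + 1) {t * d + 2..Suc t * d + 1}"

text \<open>The greedy path ends at the last vertex of block number \<open>greedy_end d H t\<close>, i.e. at the vertex
  \<open>greedy_end d H t * d + 1\<close>; number \<open>0\<close> stands for the vertex \<open>1\<close>.\<close>

primrec greedy_end :: "nat \<Rightarrow> nat set set \<Rightarrow> nat \<Rightarrow> nat" where
  "greedy_end d H 0 = 0"
| "greedy_end d H (Suc t) =
    (if block_edge d (greedy_end d H t) t \<in> H then Suc t else greedy_end d H t)"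

lemma greedy_end_le: "greedy_end d H t \<le> t"
  by (induction t) auto

definition greedy_failures :: "nat \<Rightarrow> nat set set \<Rightarrow> nat \<Rightarrow> nat set" where
  "greedy_failures d H m = {t. t < m \<and> block_edge d (greedy_end d H t) t \<notin> H}"

lemma finite_greedy_failures [simp]: "finite (greedy_failures d H m)"
  by (simp add: greedy_failures_def)

lemma card_greedy_failures_le: "card (greedy_failures d H m) \<le> m"
proof -
  have "greedy_failures d H m \<subseteq> {..<m}"
    by (auto simp: greedy_failures_def)
  from card_mono[OF _ this] show ?thesis
    by simp
qed

lemma greedy_failures_Suc:
  "greedy_failures d H (Suc m) =
    (if block_edge d (greedy_end d H m) m \<in> H then greedy_failures d H m
     else insert m (greedy_failures d H m))"
  by (auto simp: greedy_failures_def less_Suc_eq)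

text \<open>The last vertex is part of the induction claim, since the next tested edge must start
  there.\<close>

lemma greedy_path:
  assumes "r \<ge> 2"
  shows "\<exists>v. ordered_loose_path r (m * (r - 1) + 1) H (m - card (greedy_failures (r - 1) H m)) v \<and>
    v ((m - card (greedy_failures (r - 1) H m)) * (r - 1) + 1) = greedy_end (r - 1) H m * (r - 1) + 1"
proof (induction m)
  case 0
  show ?case
    by (rule exI[of _ "\<lambda>_. 1"])
      (auto simp: ordered_loose_path_def strict_mono_on_def greedy_failures_def)
next
  case (Suc m)
  let ?d = "r - 1" and ?l = "m - card (greedy_failures (r - 1) H m)"
  let ?n = "m * ?d + 1"
  obtain v where v: "ordered_loose_path r ?n H ?l v" "v (?l * ?d + 1) = greedy_end ?d H m * ?d + 1"
    using Suc.IH by blast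
  show ?case
  proof (cases "block_edge ?d (greedy_end ?d H m) m \<in> H")
    case True
    have "insert (v (?l * ?d + 1)) {?n + 1..?n + ?d} = block_edge ?d (greedy_end ?d H m) m"
      unfolding v(2) block_edge_def by (simp add: add.commute)
    with True have "ordered_loose_path r (?n + ?d) H (Suc ?l)
        (\<lambda>j. if j \<le> ?l * ?d + 1 then v j else ?n + (j - (?l * ?d + 1)))"
      by (intro ordered_loose_path_extend[OF v(1)]) simp
    \<comment> \<open>Subtraction is truncated, so this relies on there being at most
      \<open>m\<close> failures.\<close>
    moreover have "Suc m - card (greedy_failures ?d H (Suc m)) = Suc ?l"
      using True card_greedy_failures_le[of ?d H m] by (simp add: greedy_failures_Suc)
    moreover have "?n + ?d = Suc m * ?d + 1"
      by simp
    ultimately show ?thesis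
      using True assms by (intro exI[of _ "\<lambda>j. if j \<le> ?l * ?d + 1 then v j else ?n + (j - (?l * ?d + 1))"])
        (simp del: mult_Suc, simp)
  next
    case False
    have "m \<notin> greedy_failures ?d H m"
      by (simp add: greedy_failures_def)
    then have "Suc m - card (greedy_failures ?d H (Suc m)) = ?l"
      using False by (simp add: greedy_failures_Suc)
    moreover have "ordered_loose_path r (Suc m * ?d + 1) H ?l v"
      using v(1) by (rule ordered_loose_path_mono) simp
    ultimately show ?thesis
      using False v(2) by auto
  qed
qed

section \<open>Deterministic bounds on the maximal length\<close>

lemma max_path_length_ge:
  assumes "r \<ge> 2" "m * (r - 1) + 1 \<le> n"
  shows "m - card (greedy_failures (r - 1) H m) \<le> max_path_length r n H"
proof -
  obtain v where "ordered_loose_path r n H (m - card (greedy_failures (r - 1) H m)) v"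
    using greedy_path[OF assms(1)] ordered_loose_path_mono[OF _ assms(2)] by blast
  then show ?thesis
    unfolding max_path_length_def using finite_path_lengths[OF assms(1)] by (intro Max_ge) auto
qed

lemma max_path_length_le:
  assumes "r \<ge> 2" "n \<ge> 1"
  shows "max_path_length r n H * (r - 1) + 1 \<le> n"
proof -
  have "max_path_length r n H \<in> {l. \<exists>v. ordered_loose_path r n H l v}"
    unfolding max_path_length_def using path_lengths_nonempty[OF assms(2), of r H]
    by (intro Max_in finite_path_lengths assms) blast
  then show ?thesis
    using ordered_loose_path_length_le by blast
qed

section \<open>The law of a tested edge and the expected number of failures\<close>

text \<open>The first \<open>t\<close> blocks end at vertex \<open>t * d + 1\<close>, so every edge
  tested before step \<open>t\<close> lies below it.\<close>

lemma greedy_end_cong: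
  assumes "\<And>e. e \<subseteq> {..t * d + 1} \<Longrightarrow> e \<in> H \<longleftrightarrow> e \<in> H'"
  shows "greedy_end d H t = greedy_end d H' t"
  using assms
proof (induction t)
  case (Suc t)
  have "greedy_end d H t * d \<le> t * d"
    by (rule mult_le_mono1[OF greedy_end_le])
  then have "greedy_end d H t * d + 1 \<le> Suc t * d + 1"
    unfolding mult_Suc by linarith
  then have "block_edge d (greedy_end d H t) t \<subseteq> {..Suc t * d + 1}"
    unfolding block_edge_def by auto
  moreover have "greedy_end d H t = greedy_end d H' t"
  proof (rule Suc.IH)
    fix e assume "e \<subseteq> {..t * d + 1}"
    moreover have "{..t * d + 1} \<subseteq> {..Suc t * d + 1}"
      by simp
    ultimately show "e \<in> H \<longleftrightarrow> e \<in> H'"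
      by (intro Suc.prems) (rule subset_trans)
  qed
  ultimately show ?case
    using Suc.prems by simp
qed simp

lemma block_edge_in_nsets:
  assumes "u \<le> t" "Suc t * d + 1 \<le> n"
  shows "block_edge d u t \<in> nsets {1..n} (Suc d)"
proof -
  have "u * d \<le> t * d" "Suc t * d = d + t * d"
    using assms(1) by simp_all
  then have "u * d + 1 \<notin> {t * d + 2..Suc t * d + 1}" "u * d + 1 \<le> n"
    using assms(2) unfolding atLeastAtMost_iff by linarith+
  then show ?thesis
    using assms(2) by (auto simp: block_edge_def nsets_def card_insert_disjoint)
qed

text \<open>The greedy end depends only on the edges inside \<open>{..t * d + 1}\<close>, whereas the tested edge is
  never contained in this set; hence the edge is fresh.\<close>

lemma block_edge_bernoulli:
  assumes p: "0 \<le> p" "p \<le> 1" and d: "d \<ge> 1" and n: "Suc t * d + 1 \<le> n"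
  shows "map_pmf (\<lambda>H. block_edge d (greedy_end d H t) t \<in> H) (random_hypergraph (Suc d) n p) =
    bernoulli_pmf p"
proof -
  \<comment> \<open>The edges in \<open>B\<close> determine the greedy end; those in
    \<open>C\<close> are sampled independently afterwards.\<close>
  define A B C where "A = nsets {1..n} (Suc d)" and "B = {e \<in> A. e \<subseteq> {..t * d + 1}}"
    and "C = A - B"
  have fin: "finite B" "finite C"
    by (simp_all add: A_def B_def C_def finite_imp_finite_nsets)
  have A_eq: "A = B \<union> C" and disj: "B \<inter> C = {}"
    by (auto simp: B_def C_def)
  let ?ber = "\<lambda>_. bernoulli_pmf p"
  let ?end = "\<lambda>f. greedy_end d {e \<in> B. f e} t"
  have end_eq: "greedy_end d {e \<in> A. if e \<in> B then f e else g e} t = ?end f" for f g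
    by (rule greedy_end_cong) (auto simp: B_def)
  have edge: "block_edge d (?end f) t \<in> C" for f
  proof -
    have "Suc t * d + 1 \<in> block_edge d (?end f) t" "Suc t * d + 1 \<notin> {..t * d + 1}"
      using d by (auto simp: block_edge_def)
    then have "\<not> block_edge d (?end f) t \<subseteq> {..t * d + 1}"
      by blast
    moreover have "block_edge d (?end f) t \<in> A"
      unfolding A_def using greedy_end_le n by (rule block_edge_in_nsets)
    ultimately show ?thesis
      by (auto simp: B_def C_def)
  qed
  have test_eq: "block_edge d (greedy_end d {e \<in> A. if e \<in> B then f e else g e} t) t
      \<in> {e \<in> A. if e \<in> B then f e else g e} \<longleftrightarrow> g (block_edge d (?end f) t)" for f g
    unfolding end_eq using edge[of f] by (simp add: C_def)
  have "map_pmf (\<lambda>H. block_edge d (greedy_end d H t) t \<in> H) (random_hypergraph (Suc d) n p) =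
      map_pmf (\<lambda>(f, g). g (block_edge d (?end f) t))
        (pair_pmf (Pi_pmf B False ?ber) (Pi_pmf C False ?ber))"
    unfolding random_hypergraph_def A_def[symmetric]
    unfolding A_eq Pi_pmf_union[OF fin disj] pmf.map_comp
    unfolding A_eq[symmetric]
    by (intro map_pmf_cong refl) (simp only: o_def case_prod_beta test_eq)
  also have "\<dots> = bind_pmf (Pi_pmf B False ?ber)
      (\<lambda>f. map_pmf (\<lambda>g. g (block_edge d (?end f) t)) (Pi_pmf C False ?ber))"
    unfolding pair_pmf_def map_pmf_def bind_assoc_pmf bind_return_pmf by simp
  \<comment> \<open>For each fixed \<open>f\<close> the tested edge is one fixed coordinate in
    \<open>C\<close>, so the inner law does not depend on \<open>f\<close>.\<close>
  also have "\<dots> = bernoulli_pmf p"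
    by (simp only: Pi_pmf_component[OF fin(2)] edge if_True bind_pmf_const)
  finally show ?thesis .
qed

text \<open>Linearity of expectation over the failure indicators, each of mean \<open>1 - p\<close>
  by \<open>block_edge_bernoulli\<close>.\<close>

lemma expectation_greedy_failures:
  assumes p: "0 \<le> p" "p \<le> 1" and d: "d \<ge> 1" and n: "m * d + 1 \<le> n"
  shows "measure_pmf.expectation (random_hypergraph (Suc d) n p)
    (\<lambda>H. real (card (greedy_failures d H m))) = real m * (1 - p)"
proof -
  let ?M = "random_hypergraph (Suc d) n p"
  let ?S = "\<lambda>t. {H. block_edge d (greedy_end d H t) t \<notin> H}"
  have prob: "measure_pmf.prob ?M (?S t) = 1 - p" if "t < m" for t
  proof -
    have "Suc t * d \<le> m * d"
      using that by (intro mult_right_mono) auto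
    then have t: "Suc t * d + 1 \<le> n"
      using n by linarith
    have "measure_pmf.prob ?M (?S t) =
        measure_pmf.prob (map_pmf (\<lambda>H. block_edge d (greedy_end d H t) t \<in> H) ?M) {False}"
      by (simp add: vimage_def)
    then show ?thesis
      unfolding block_edge_bernoulli[OF p d t] using p by (simp add: measure_pmf_single)
  qed
  have card_eq: "real (card (greedy_failures d H m)) = (\<Sum>t<m. indicator (?S t) H)" for H
  proof -
    have "greedy_failures d H m = {t \<in> {..<m}. H \<in> ?S t}"
      by (auto simp: greedy_failures_def)
    then have "real (card (greedy_failures d H m)) = (\<Sum>t \<in> {t \<in> {..<m}. H \<in> ?S t}. 1)"
      by (simp only: card_eq_sum of_nat_sum of_nat_1)
    also have "\<dots> = (\<Sum>t<m. indicator (?S t) H)"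
      unfolding indicator_def of_bool_def by (rule sum.inter_filter) simp
    finally show ?thesis .
  qed
  have "measure_pmf.expectation ?M (\<lambda>H. real (card (greedy_failures d H m))) =
      (\<Sum>t<m. measure_pmf.expectation ?M (indicator (?S t)))"
    unfolding card_eq
    by (intro Bochner_Integration.integral_sum measure_pmf.integrable_const_bound[where B = 1])
      (simp_all add: indicator_def)
  then show ?thesis
    using prob by simp
qed

text \<open>Markov's inequality for the number of failures at the threshold
  \<open>\<epsilon> * real m\<close>. This threshold must be positive, hence the separate case
  \<open>m = 0\<close>.\<close>

lemma prob_max_path_length_ge:
  assumes p: "0 \<le> p" "p \<le> 1" and r: "r \<ge> 2" and n: "m * (r - 1) + 1 \<le> n" and \<epsilon>: "\<epsilon> > 0"
  shows "measure_pmf.prob (random_hypergraph r n p)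
    {H. (1 - \<epsilon>) * real m \<le> real (max_path_length r n H)} \<ge> 1 - (1 - p) / \<epsilon>"
proof (cases "m = 0")
  case True
  then show ?thesis
    using p \<epsilon> by simp
next
  case False
  define d where "d = r - 1"
  have d: "d \<ge> 1" "r = Suc d"
    using r by (auto simp: d_def)
  let ?M = "random_hypergraph r n p"
  let ?F = "\<lambda>H. real (card (greedy_failures d H m))"
  let ?bad = "{H. \<epsilon> * real m \<le> ?F H}"
  have "integrable ?M ?F"
    by (rule measure_pmf.integrable_const_bound[where B = "real m"])
      (auto simp: card_greedy_failures_le)
  then have "measure_pmf.prob ?M ?bad \<le> measure_pmf.expectation ?M ?F / (\<epsilon> * real m)"
    using integral_Markov_inequality_measure[of "measure_pmf ?M" ?F "{}" "\<epsilon> * real m"] False \<epsilon> by simp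
  also have "\<dots> = (1 - p) / \<epsilon>"
    using False n d expectation_greedy_failures[OF p d(1), of m n] by (simp add: d_def[symmetric])
  finally have "1 - (1 - p) / \<epsilon> \<le> measure_pmf.prob ?M (- ?bad)"
    using measure_pmf.prob_compl[of ?bad ?M] by (simp add: Compl_eq_Diff_UNIV)
  also have "\<dots> \<le> measure_pmf.prob ?M {H. (1 - \<epsilon>) * real m \<le> real (max_path_length r n H)}"
  proof (rule measure_pmf.finite_measure_mono)
    show "- ?bad \<subseteq> {H. (1 - \<epsilon>) * real m \<le> real (max_path_length r n H)}"
    proof clarsimp
      fix H assume "\<not> \<epsilon> * real m \<le> ?F H"
      moreover have "real m - ?F H \<le> real (max_path_length r n H)"
        using max_path_length_ge[OF r n, of H] by (simp add: d_def)
      ultimately show "(1 - \<epsilon>) * real m \<le> real (max_path_length r n H)"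
        by (simp add: left_diff_distrib)
    qed
  qed simp
  finally show ?thesis .
qed

theorem corollary1p3:
  fixes r :: nat and p :: "nat \<Rightarrow> real"
  assumes "r \<ge> 2"
    and "\<And>n. 0 \<le> p n \<and> p n \<le> 1"
    and "p \<longlonglongrightarrow> 1"
  shows "\<exists>\<delta> :: nat \<Rightarrow> real. \<delta> \<longlonglongrightarrow> 0 \<and>
    (\<lambda>n. measure_pmf.prob (random_hypergraph r n (p n))
       {H. (1 - \<delta> n) * (real n / (real r - 1)) \<le> real (max_path_length r n H) \<and>
           real (max_path_length r n H) \<le> (1 + \<delta> n) * (real n / (real r - 1))})
      \<longlonglongrightarrow> 1"
proof -
  define d where "d = r - 1"
  have d: "d \<ge> 1" "real r - 1 = real d"
    using assms(1) by (auto simp: d_def)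
  \<comment> \<open>The summand \<open>1 / Suc n\<close> keeps \<open>\<epsilon>\<close> positive where \<open>p n = 1\<close>.\<close>
  define \<epsilon> where "\<epsilon> n = sqrt (1 - p n) + 1 / real (Suc n)" for n
  \<comment> \<open>Multiplied by \<open>real n / real d\<close>, the second summand becomes 1,
    which pays for the rounding in the number of blocks.\<close>
  define \<delta> where "\<delta> n = \<epsilon> n + real d / real n" for n
  have sqrt_lim: "(\<lambda>n. sqrt (1 - p n)) \<longlonglongrightarrow> 0"
    using tendsto_real_sqrt[OF tendsto_diff[OF tendsto_const assms(3), of 1]] by simp
  have "\<epsilon> \<longlonglongrightarrow> 0"
    unfolding \<epsilon>_def using tendsto_add[OF sqrt_lim LIMSEQ_Suc[OF lim_1_over_n]] by simp
  then have "\<delta> \<longlonglongrightarrow> 0"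
    unfolding \<delta>_def using tendsto_add[OF _ lim_const_over_n[of "real d"]] by fastforce
  let ?good = "\<lambda>n. {H. (1 - \<delta> n) * (real n / (real r - 1)) \<le> real (max_path_length r n H) \<and>
           real (max_path_length r n H) \<le> (1 + \<delta> n) * (real n / (real r - 1))}"
  let ?P = "\<lambda>n. measure_pmf.prob (random_hypergraph r n (p n)) (?good n)"
  have lower: "1 - sqrt (1 - p n) \<le> ?P n" if n: "n \<ge> 1" for n
  proof -
    \<comment> \<open>The number of complete blocks that fit after vertex 1.\<close>
    define m where "m = (n - 1) div d"
    have q: "0 \<le> 1 - p n" and \<epsilon>_pos: "\<epsilon> n > 0"
      using assms(2)[of n] by (auto simp: \<epsilon>_def intro: add_nonneg_pos)
    have "m * d \<le> n - 1"
      by (simp add: m_def)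
    then have mn: "m * (r - 1) + 1 \<le> n"
      using n by (simp add: d_def)
    have "n - 1 < Suc m * d"
      using d(1) dividend_less_times_div[of d "n - 1"] by (simp add: m_def algebra_simps)
    then have "n \<le> Suc m * d"
      by linarith
    then have "real n \<le> real (Suc m * d)"
      by (rule of_nat_mono)
    then have m_ge: "real n / real d - 1 \<le> real m"
      using d(1) by (simp add: field_simps)
    have "real (m * d) \<le> real n"
      using \<open>m * d \<le> n - 1\<close> by (intro of_nat_mono) simp
    then have m_le: "real m \<le> real n / real d"
      using d(1) by (simp add: field_simps)
    \<comment> \<open>As \<open>\<epsilon> n\<close> is at least \<open>sqrt (1 - p n)\<close>, the
      Markov bound \<open>(1 - p n) / \<epsilon> n\<close> is at most
      \<open>sqrt (1 - p n)\<close>.\<close>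
    have "1 - p n = sqrt (1 - p n) * sqrt (1 - p n)"
      using q by simp
    also have "\<dots> \<le> sqrt (1 - p n) * \<epsilon> n"
      using q by (intro mult_left_mono) (auto simp: \<epsilon>_def)
    finally have "1 - sqrt (1 - p n) \<le> 1 - (1 - p n) / \<epsilon> n"
      using \<epsilon>_pos by (simp add: field_simps)
    also have "\<dots> \<le> measure_pmf.prob (random_hypergraph r n (p n))
        {H. (1 - \<epsilon> n) * real m \<le> real (max_path_length r n H)}"
      using assms(1,2) mn \<epsilon>_pos by (intro prob_max_path_length_ge) auto
    also have "\<dots> \<le> ?P n"
    proof (rule measure_pmf.finite_measure_mono)
      have "(1 - \<delta> n) * (real n / real d) = real n / real d - \<epsilon> n * (real n / real d) - 1"
        using n d(1) by (simp add: \<delta>_def field_simps)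
      also have "\<dots> \<le> real m - \<epsilon> n * real m"
        using m_ge mult_left_mono[OF m_le, of "\<epsilon> n"] \<epsilon>_pos by linarith
      finally have lo: "(1 - \<delta> n) * (real n / real d) \<le> (1 - \<epsilon> n) * real m"
        by (simp add: left_diff_distrib)
      \<comment> \<open>The upper bound holds for every \<open>H\<close>, by counting the vertices
        of a path.\<close>
      have up: "real (max_path_length r n H) \<le> (1 + \<delta> n) * (real n / real d)" for H
      proof -
        have "real (max_path_length r n H * d) \<le> real n"
          using max_path_length_le[OF assms(1) n, of H] by (intro of_nat_mono) (simp add: d_def)
        then have "real (max_path_length r n H) \<le> real n / real d"
          using d(1) by (simp add: field_simps)
        also have "\<dots> \<le> (1 + \<delta> n) * (real n / real d)"
          using \<epsilon>_pos mult_right_mono[of 1 "1 + \<delta> n" "real n / real d"] by (simp add: \<delta>_def)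
        finally show ?thesis .
      qed
      show "{H. (1 - \<epsilon> n) * real m \<le> real (max_path_length r n H)} \<subseteq> ?good n"
        unfolding d(2) using order_trans[OF lo] up by blast
    qed simp
    finally show ?thesis .
  qed
  have "?P \<longlonglongrightarrow> 1"
  proof (rule real_tendsto_sandwich[where h = "\<lambda>_. 1"])
    show "eventually (\<lambda>n. 1 - sqrt (1 - p n) \<le> ?P n) sequentially"
      using eventually_ge_at_top[of 1] by (rule eventually_mono) (rule lower)
    show "(\<lambda>n. 1 - sqrt (1 - p n)) \<longlonglongrightarrow> 1"
      using tendsto_diff[OF tendsto_const sqrt_lim, of 1] by simp
  qed simp_all
  with \<open>\<delta> \<longlonglongrightarrow> 0\<close> show ?thesis
    by blast
qed

end
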